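(* Let $n,m\ge 2$ be integers. If $n=3t$ and $m=3r+1$ for some nonnegative integers $t,r$, then $$b(P_n\boxtimes P_m)=2.$$
   Context: All graphs are finite, simple and undirected. $P_k$ denotes the path with $k$ vertices. The strong product $G\boxtimes H$ of graphs $G$ and $H$ has vertex set $V(G)\times V(H)$, and two vertices $(v,u)$ and $(v',u')$ are adjacent if and only if ($v=v'$ and $u\sim u'$), or ($v\sim v'$ and $u=u'$), or ($v\sim v'$ and $u\sim u'$), where $\sim$ denotes adjacency. A set $D$ of vertices of $G$ is dominating if every vertex of $G$ is in $D$ or adjacent to a vertex of $D$; the domination number $\gamma(G)$ is the minimum cardinality of a dominating set. For a graph $G$ with nonempty edge set $E$, the bondage number $b(G)$ is the minimum cardinality of a set $E'\subseteq E$ such that $\gamma(G-E')>\gamma(G)$, where $G-E'$ is obtained from $G$ by deleting the edges of $E'$ and keeping all vertices. *)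

theory Defs
  imports Main
begin

record 'a sgraph =
  verts :: "'a set"
  edges :: "'a set set"

definition simple_graph :: "'a sgraph \<Rightarrow> bool" where
  "simple_graph G \<longleftrightarrow> finite (verts G) \<and> (\<forall>e\<in>edges G. e \<subseteq> verts G \<and> card e = 2)"

definition adjacent :: "'a sgraph \<Rightarrow> 'a \<Rightarrow> 'a \<Rightarrow> bool" where
  "adjacent G u v \<longleftrightarrow> {u, v} \<in> edges G"

(* The path with k vertices (not k edges). *)
definition path_graph :: "nat \<Rightarrow> nat sgraph" where
  "path_graph k = \<lparr>verts = {..<k}, edges = {{i, Suc i} | i. Suc i < k}\<rparr>"

definition strong_product :: "'a sgraph \<Rightarrow> 'b sgraph \<Rightarrow> ('a \<times> 'b) sgraph" where
  "strong_product G H =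
    \<lparr>verts = verts G \<times> verts H,
     edges = {{(v, u), (v', u')} | v u v' u'.
       v \<in> verts G \<and> v' \<in> verts G \<and> u \<in> verts H \<and> u' \<in> verts H \<and>
       (v = v' \<and> adjacent H u u' \<or>
        adjacent G v v' \<and> u = u' \<or>
        adjacent G v v' \<and> adjacent H u u')}\<rparr>"

definition dominating :: "'a sgraph \<Rightarrow> 'a set \<Rightarrow> bool" where
  "dominating G D \<longleftrightarrow> D \<subseteq> verts G \<and> (\<forall>v\<in>verts G. v \<in> D \<or> (\<exists>u\<in>D. adjacent G v u))"

(* Since the library cardinality of an infinite set is 0, this is meaningful for finite
   graphs only; the same holds for the bondage number below. *)
definition domination_number :: "'a sgraph \<Rightarrow> nat" where
  "domination_number G = (LEAST k. \<exists>D. dominating G D \<and> card D = k)"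

definition delete_edges :: "'a sgraph \<Rightarrow> 'a set set \<Rightarrow> 'a sgraph" where
  "delete_edges G E' = \<lparr>verts = verts G, edges = edges G - E'\<rparr>"

(* The minimum is attained whenever G is a simple graph with at least one edge, see
   bondage_set_exists; for edgeless graphs the value is unspecified. *)
definition bondage_number :: "'a sgraph \<Rightarrow> nat" where
  "bondage_number G =
    (LEAST k. \<exists>E'. E' \<subseteq> edges G \<and> card E' = k \<and>
                   domination_number (delete_edges G E') > domination_number G)"

lemma simple_graph_path_graph: "simple_graph (path_graph k)"
  unfolding simple_graph_def path_graph_def by auto

lemma simple_graph_delete_edges: "simple_graph G \<Longrightarrow> simple_graph (delete_edges G E')"
  unfolding simple_graph_def delete_edges_def by auto

lemma simple_graph_not_adjacent_self: "simple_graph G \<Longrightarrow> \<not> adjacent G v v"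
  unfolding simple_graph_def adjacent_def by force

lemma simple_graph_strong_product:
  assumes "simple_graph G" "simple_graph H"
  shows "simple_graph (strong_product G H)"
proof -
  have "finite (verts G \<times> verts H)"
    using assms by (simp add: simple_graph_def)
  moreover note simple_graph_not_adjacent_self[OF assms(1)] simple_graph_not_adjacent_self[OF assms(2)]
  ultimately show ?thesis
    unfolding simple_graph_def[of "strong_product G H"]
    by (auto simp: strong_product_def card_insert_if)
qed

lemma adjacent_strong_product:
  assumes "simple_graph G" "simple_graph H"
    and "v \<in> verts G" "v' \<in> verts G" "u \<in> verts H" "u' \<in> verts H"
  shows "adjacent (strong_product G H) (v, u) (v', u') \<longleftrightarrow>
    v = v' \<and> adjacent H u u' \<or> adjacent G v v' \<and> u = u' \<or> adjacent G v v' \<and> adjacent H u u'"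
  using assms(3-)
  by (auto simp: strong_product_def adjacent_def doubleton_eq_iff insert_commute)

lemma bondage_set_exists:
  assumes "simple_graph G" "edges G \<noteq> {}"
  shows "\<exists>E'\<subseteq>edges G. domination_number (delete_edges G E') > domination_number G"
proof (intro exI conjI)
  let ?H = "delete_edges G (edges G)"
  have fin: "finite (verts G)"
    using assms by (simp add: simple_graph_def)
  have "dominating ?H D \<longleftrightarrow> D = verts G" for D
    by (auto simp: dominating_def delete_edges_def adjacent_def)
  then have H: "domination_number ?H = card (verts G)"
    unfolding domination_number_def by (simp add: Least_equality)
  obtain e where e: "e \<in> edges G"
    using assms by blast
  then have "card e = 2" "e \<subseteq> verts G"
    using assms by (auto simp: simple_graph_def)
  then obtain u v where uv: "e = {u, v}" "u \<noteq> v" "u \<in> verts G" "v \<in> verts G"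
    by (auto simp: card_2_iff)
  have "dominating G (verts G - {u})"
    using uv e unfolding dominating_def adjacent_def by auto
  then have "domination_number G \<le> card (verts G - {u})"
    unfolding domination_number_def by (intro Least_le) blast
  also have "\<dots> < card (verts G)"
    using fin uv by (intro psubset_card_mono) auto
  finally show "domination_number G < domination_number ?H"
    using H by simp
qed simp

end

theory Submission
  imports Defs
begin

text \<open>
  The strong product of two paths is the king's graph: distinct cells are adjacent when both
  coordinates differ by at most one.  Its domination number here is \<open>t * (r + 1)\<close>.

  For the lower bound, the \<open>t * (r + 1)\<close> cells \<open>(3a + 2, 3b)\<close> have pairwise disjoint closed
  neighbourhoods, each of which meets every dominating set.  None of these neighbourhoods
  reaches row 0, so a dominating set with a cell in row 0 has at least \<open>t * (r + 1) + 1\<close>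
  elements (\<open>packing_bound\<close>).  This gives the upper bound on the bondage number:
  if the edges from the corner \<open>(0, 0)\<close> to \<open>(1, 0)\<close> and \<open>(1, 1)\<close> are deleted, then only
  \<open>(0, 0)\<close> and \<open>(0, 1)\<close> can still dominate the corner, and both lie in row 0.

  Conversely, no single edge suffices.  The rows split into \<open>t\<close> strips of height three, and a
  dominating set of minimum size arises from placing, in the middle row of each strip, a
  dominating set of \<open>r + 1\<close> columns of the path on \<open>3r + 1\<close> vertices.  There is enough slack in
  the choice of these columns that for any deleted edge one choice dominates every cell without
  using that edge (\<open>column_assignment\<close>).
\<close>

section \<open>Domination numbers\<close>

lemma domination_number_le:
  "dominating G D \<Longrightarrow> domination_number G \<le> card D"
  unfolding domination_number_def by (intro Least_le) blast

lemma domination_number_ge: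
  assumes "\<And>D. dominating G D \<Longrightarrow> k \<le> card D"
  shows "k \<le> domination_number G"
proof -
  have "dominating G (verts G)"
    by (simp add: dominating_def)
  then have "\<exists>k D. dominating G D \<and> card D = k"
    by blast
  then have "\<exists>D. dominating G D \<and> card D = domination_number G"
    unfolding domination_number_def by (rule LeastI_ex)
  then show ?thesis
    using assms by metis
qed

lemma dominating_delete_edges_imp:
  "dominating (delete_edges G E') D \<Longrightarrow> dominating G D"
  by (auto simp: dominating_def delete_edges_def adjacent_def)

lemma delete_edges_empty [simp]: "delete_edges G {} = G"
  by (simp add: delete_edges_def)

section \<open>The king's graph\<close>

definition near :: "nat \<Rightarrow> nat \<Rightarrow> bool" where
  "near i j \<longleftrightarrow> i \<le> Suc j \<and> j \<le> Suc i"

lemma adjacent_path_graph: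
  "adjacent (path_graph k) i j \<longleftrightarrow> i < k \<and> j < k \<and> i \<noteq> j \<and> near i j"
proof
  assume "adjacent (path_graph k) i j"
  then show "i < k \<and> j < k \<and> i \<noteq> j \<and> near i j"
    by (auto simp: adjacent_def path_graph_def near_def doubleton_eq_iff)
next
  assume "i < k \<and> j < k \<and> i \<noteq> j \<and> near i j"
  then have "(j = Suc i \<or> i = Suc j) \<and> i < k \<and> j < k"
    by (auto simp: near_def)
  then show "adjacent (path_graph k) i j"
    by (auto simp: adjacent_def path_graph_def doubleton_eq_iff)
qed

lemma verts_path_graph [simp]: "verts (path_graph k) = {..<k}"
  by (simp add: path_graph_def)

abbreviation king_graph :: "nat \<Rightarrow> nat \<Rightarrow> (nat \<times> nat) sgraph" where
  "king_graph n m \<equiv> strong_product (path_graph n) (path_graph m)"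

lemma verts_king_graph [simp]: "verts (king_graph n m) = {..<n} \<times> {..<m}"
  by (simp add: strong_product_def)

lemma near_refl [simp]: "near i i"
  by (simp add: near_def)

lemma adjacent_king_graph:
  assumes "u \<in> {..<n} \<times> {..<m}" "v \<in> {..<n} \<times> {..<m}"
  shows "adjacent (king_graph n m) u v \<longleftrightarrow>
    u \<noteq> v \<and> near (fst u) (fst v) \<and> near (snd u) (snd v)"
proof -
  obtain i j i' j' where uv: "u = (i, j)" "v = (i', j')"
    by (cases u, cases v)
  then have "i < n" "i' < n" "j < m" "j' < m"
    using assms by auto
  then show ?thesis
    unfolding uv
    by (subst adjacent_strong_product)
       (auto simp: simple_graph_path_graph adjacent_path_graph)
qed

lemma dominating_delete_edges_king_graph:
  "dominating (delete_edges (king_graph n m) E') D \<longleftrightarrow>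
    D \<subseteq> {..<n} \<times> {..<m} \<and>
    (\<forall>v\<in>{..<n} \<times> {..<m}. v \<in> D \<or>
      (\<exists>u\<in>D. u \<noteq> v \<and> near (fst v) (fst u) \<and> near (snd v) (snd u) \<and> {v, u} \<notin> E'))"
proof -
  have adj: "adjacent (delete_edges (king_graph n m) E') v u \<longleftrightarrow>
      u \<noteq> v \<and> near (fst v) (fst u) \<and> near (snd v) (snd u) \<and> {v, u} \<notin> E'"
    if "u \<in> {..<n} \<times> {..<m}" "v \<in> {..<n} \<times> {..<m}" for u v
    using adjacent_king_graph[OF that(2,1)]
    by (auto simp: adjacent_def delete_edges_def)
  have verts: "verts (delete_edges (king_graph n m) E') = {..<n} \<times> {..<m}"
    by (simp add: delete_edges_def)
  show ?thesis
  proof (cases "D \<subseteq> {..<n} \<times> {..<m}")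
    case True
    then have "(\<exists>u\<in>D. adjacent (delete_edges (king_graph n m) E') v u) \<longleftrightarrow>
        (\<exists>u\<in>D. u \<noteq> v \<and> near (fst v) (fst u) \<and> near (snd v) (snd u) \<and> {v, u} \<notin> E')"
      if "v \<in> {..<n} \<times> {..<m}" for v
      using adj[OF _ that] by (intro bex_cong) auto
    then show ?thesis
      using True unfolding dominating_def verts by simp
  next
    case False
    then show ?thesis
      unfolding dominating_def verts by simp
  qed
qed

lemma finite_dominating_king_graph:
  "dominating (king_graph n m) D \<Longrightarrow> finite D"
  unfolding dominating_def verts_king_graph
  by (metis finite_cartesian_product finite_lessThan finite_subset)

section \<open>Lower bounds from a packing\<close>

text \<open>
  The closed neighbourhoods of the cells \<open>(3a + 2, 3b)\<close> are pairwise disjoint, so the cells that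
  dominate them are distinct.  None of these is in row 0; keeping this information in the
  conclusion is what makes cells of row 0 count as a surplus.
\<close>

lemma packing_bound:
  assumes "dominating (king_graph (3 * t) (3 * r + 1)) D"
  shows "t * (r + 1) \<le> card {v \<in> D. fst v \<noteq> 0}"
proof -
  let ?I = "{..<t} \<times> {..r}"
  have "dominating (delete_edges (king_graph (3 * t) (3 * r + 1)) {}) D"
    using assms by simp
  then have dom: "\<And>v. v \<in> {..<3 * t} \<times> {..<3 * r + 1} \<Longrightarrow>
      \<exists>u\<in>D. near (fst v) (fst u) \<and> near (snd v) (snd u)"
    unfolding dominating_delete_edges_king_graph by (metis near_refl)
  have "\<forall>p\<in>?I. \<exists>u. u \<in> D \<and> near (3 * fst p + 2) (fst u) \<and> near (3 * snd p) (snd u)"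
  proof
    fix p assume "p \<in> ?I"
    then have "(3 * fst p + 2, 3 * snd p) \<in> {..<3 * t} \<times> {..<3 * r + 1}"
      by auto
    from dom[OF this] show "\<exists>u. u \<in> D \<and> near (3 * fst p + 2) (fst u) \<and> near (3 * snd p) (snd u)"
      unfolding fst_conv snd_conv by blast
  qed
  from bchoice[OF this] obtain f where
    "\<forall>p\<in>?I. f p \<in> D \<and> near (3 * fst p + 2) (fst (f p)) \<and> near (3 * snd p) (snd (f p))" ..
  then have f: "f p \<in> D" "near (3 * fst p + 2) (fst (f p))" "near (3 * snd p) (snd (f p))"
    if "p \<in> ?I" for p
    using that by blast+
  have "inj_on f ?I"
  proof (rule inj_onI)
    fix p q assume "p \<in> ?I" "q \<in> ?I" "f p = f q"
    then have "fst p = fst q" "snd p = snd q"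
      using f(2,3)[OF \<open>p \<in> ?I\<close>] f(2,3)[OF \<open>q \<in> ?I\<close>] \<open>f p = f q\<close>
      unfolding near_def by simp_all
    then show "p = q"
      by (rule prod_eqI)
  qed
  moreover have "f ` ?I \<subseteq> {v \<in> D. fst v \<noteq> 0}"
  proof (rule image_subsetI)
    fix p assume "p \<in> ?I"
    then show "f p \<in> {v \<in> D. fst v \<noteq> 0}"
      using f(1,2)[of p] by (simp add: near_def)
  qed
  moreover have "finite D"
    using assms by (rule finite_dominating_king_graph)
  ultimately have "card ?I \<le> card {v \<in> D. fst v \<noteq> 0}"
    by (intro card_inj_on_le) auto
  then show ?thesis
    by simp
qed

lemma domination_number_king_graph_ge:
  "t * (r + 1) \<le> domination_number (king_graph (3 * t) (3 * r + 1))"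
proof (rule domination_number_ge)
  fix D assume D: "dominating (king_graph (3 * t) (3 * r + 1)) D"
  then have "finite D"
    by (rule finite_dominating_king_graph)
  then have "card {v \<in> D. fst v \<noteq> 0} \<le> card D"
    by (intro card_mono) auto
  then show "t * (r + 1) \<le> card D"
    using packing_bound[OF D] by linarith
qed

text \<open>
  With both edges to row 1 gone, the corner has only its neighbour in row 0 left.
\<close>

lemma domination_number_corner_deleted:
  assumes "t > 0"
  shows "t * (r + 1) <
    domination_number (delete_edges (king_graph (3 * t) (3 * r + 1))
      {{(0, 0), (1, 0)}, {(0, 0), (1, 1)}})"
    (is "_ < domination_number ?G")
proof -
  have "Suc (t * (r + 1)) \<le> card D" if D: "dominating ?G D" for D
  proof -
    have "(0, 0) \<in> {..<3 * t} \<times> {..<3 * r + 1}"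
      using assms by simp
    with D have "(0, 0) \<in> D \<or> (\<exists>u\<in>D. near 0 (fst u) \<and> near 0 (snd u) \<and>
        {(0, 0), u} \<notin> {{(0, 0), (1, 0)}, {(0, 0), (1, 1)}})"
      unfolding dominating_delete_edges_king_graph by (metis fst_conv snd_conv)
    then obtain u where u: "u \<in> D" "fst u = 0"
    proof
      assume "\<exists>u\<in>D. near 0 (fst u) \<and> near 0 (snd u) \<and>
        {(0, 0), u} \<notin> {{(0, 0), (1, 0)}, {(0, 0), (1, 1)}}"
      then obtain u where u: "u \<in> D" "near 0 (fst u)" "near 0 (snd u)" "u \<noteq> (1, 0)" "u \<noteq> (1, 1)"
        by blast
      then have "fst u = 0"
        by (cases u) (auto simp: near_def le_Suc_eq)
      then show ?thesis
        using u(1) that by blast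
    qed (use that in auto)
    have G: "dominating (king_graph (3 * t) (3 * r + 1)) D"
      using D by (rule dominating_delete_edges_imp)
    then have "finite D"
      by (rule finite_dominating_king_graph)
    moreover have "{v \<in> D. fst v \<noteq> 0} \<subset> D"
      using u by blast
    ultimately have "card {v \<in> D. fst v \<noteq> 0} < card D"
      by (rule psubset_card_mono)
    then show ?thesis
      using packing_bound[OF G] by linarith
  qed
  then have "Suc (t * (r + 1)) \<le> domination_number ?G"
    by (rule domination_number_ge)
  then show ?thesis
    by simp
qed

section \<open>Minimum dominating sets that avoid a given edge\<close>

text \<open>
  Each of the column sets \<open>{0, 3, \<dots>, 3r}\<close>, \<open>{1, 4, \<dots>, 3r - 2, 3r}\<close> and \<open>{0, 2, 5, \<dots>, 3r - 1}\<close>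
  dominates the path.  Assign to each column \<open>k\<close> a dominating column \<open>c b\<close> with \<open>b\<close> equal to
  \<open>(k + 1) div 3\<close>, \<open>k div 3\<close> and \<open>(k + 2) div 3\<close> respectively.  The three assignments use,
  respectively, no two columns with residues 1 and 2, with residues 2 and 0, and with
  residues 0 and 1 modulo 3.  Hence some assignment does not use the pair of columns
  \<open>{j, j'}\<close>.  If \<open>j = j'\<close>, the first one works unless 3 divides \<open>j\<close>; the second works for
  multiples of 3 other than \<open>3r\<close>, and the third for those other than 0.
\<close>

lemma column_assignment:
  assumes "r > 0" "near j j'" "j \<le> 3 * r" "j' \<le> 3 * r"
  obtains c where "\<And>b. b \<le> r \<Longrightarrow> c b \<le> 3 * r"
    and "\<And>k. k \<le> 3 * r \<Longrightarrow> \<exists>b\<le>r. near k (c b) \<and> {k, c b} \<noteq> {j, j'}"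
proof -
  have "j' = j \<or> j' = Suc j \<or> j = Suc j'"
    using assms(2) unfolding near_def by linarith
  then have "j mod 3 \<noteq> 0 \<and> j' mod 3 \<noteq> 0 \<or>
      j mod 3 \<noteq> 1 \<and> j' mod 3 \<noteq> 1 \<and> \<not> (j = 3 * r \<and> j' = 3 * r) \<or>
      j mod 3 \<noteq> 2 \<and> j' mod 3 \<noteq> 2 \<and> \<not> (j = 0 \<and> j' = 0)"
    using \<open>r > 0\<close> by (elim disjE; simp; presburger)
  then consider "j mod 3 \<noteq> 0" "j' mod 3 \<noteq> 0"
    | "j mod 3 \<noteq> 1" "j' mod 3 \<noteq> 1" "\<not> (j = 3 * r \<and> j' = 3 * r)"
    | "j mod 3 \<noteq> 2" "j' mod 3 \<noteq> 2" "\<not> (j = 0 \<and> j' = 0)"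
    by blast
  then show thesis
  proof cases
    case 1
    have "\<exists>b\<le>r. near k (3 * b) \<and> {k, 3 * b} \<noteq> {j, j'}" if "k \<le> 3 * r" for k
    proof -
      let ?b = "(k + 1) div 3"
      have "?b \<le> r" "near k (3 * ?b)"
        using that unfolding near_def by linarith+
      moreover have "3 * ?b \<noteq> j" "3 * ?b \<noteq> j'"
        using 1 by auto
      ultimately show ?thesis
        by (metis insert_iff singletonD)
    qed
    then show ?thesis
      by (intro that[of "\<lambda>b. 3 * b"]) auto
  next
    case 2
    have "\<exists>b\<le>r. near k (min (3 * b + 1) (3 * r)) \<and> {k, min (3 * b + 1) (3 * r)} \<noteq> {j, j'}"
      if "k \<le> 3 * r" for k
    proof (cases "k = 3 * r")
      case True
      then have "{k, min (3 * r + 1) (3 * r)} \<noteq> {j, j'}"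
        using 2(3) by (auto simp: doubleton_eq_iff)
      moreover have "near k (min (3 * r + 1) (3 * r))"
        using True by simp
      ultimately show ?thesis
        by blast
    next
      case False
      let ?b = "k div 3"
      have b: "?b < r"
        using False that by linarith
      then have "min (3 * ?b + 1) (3 * r) = 3 * ?b + 1"
        by simp
      moreover have "near k (3 * ?b + 1)"
        unfolding near_def by linarith
      moreover have "(3 * ?b + 1) mod 3 = 1"
        by presburger
      then have "3 * ?b + 1 \<noteq> j" "3 * ?b + 1 \<noteq> j'"
        using 2 by metis+
      ultimately show ?thesis
        using b by (metis insert_iff singletonD less_imp_le)
    qed
    then show ?thesis
      by (intro that[of "\<lambda>b. min (3 * b + 1) (3 * r)"]) auto
  next
    case 3
    have "\<exists>b\<le>r. near k (3 * b - 1) \<and> {k, 3 * b - 1} \<noteq> {j, j'}" if "k \<le> 3 * r" for k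
    proof (cases "k = 0")
      case True
      \<comment> \<open>Truncated subtraction turns \<open>b = 0\<close> into the boundary column 0.\<close>
      then have "near k (3 * 0 - 1)" "{k, 3 * 0 - 1} \<noteq> {j, j'}"
        using 3(3) by (auto simp: doubleton_eq_iff)
      then show ?thesis
        by blast
    next
      case False
      let ?b = "(k + 2) div 3"
      have b: "?b \<le> r" "near k (3 * ?b - 1)"
        using that False unfolding near_def by linarith+
      have "?b > 0"
        using False by linarith
      then obtain q where "?b = Suc q"
        using gr0_conv_Suc by blast
      then have "3 * ?b - 1 = 3 * q + 2"
        by simp
      then have "(3 * ?b - 1) mod 3 = 2"
        by presburger
      then have "3 * ?b - 1 \<noteq> j" "3 * ?b - 1 \<noteq> j'"
        using 3 by metis+
      then show ?thesis
        using b by (metis insert_iff singletonD)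
    qed
    then show ?thesis
      by (intro that[of "\<lambda>b. 3 * b - 1"]) auto
  qed
qed

text \<open>
  Every cell is dominated from the middle row of its strip, by a cell in its assigned column.
  The edge used (if any) projects onto a pair of columns different from that of the deleted edge.
  The case \<open>E' = {}\<close> is the upper bound on the domination number of the graph itself.
\<close>

lemma domination_number_delete_edge_le:
  assumes "r > 0" "near j j'" "j \<le> 3 * r" "j' \<le> 3 * r"
    and E': "E' \<subseteq> {{(i, j), (i', j')}}"
  shows "domination_number (delete_edges (king_graph (3 * t) (3 * r + 1)) E') \<le> t * (r + 1)"
proof -
  obtain c where c: "\<And>b. b \<le> r \<Longrightarrow> c b \<le> 3 * r"
    "\<And>k. k \<le> 3 * r \<Longrightarrow> \<exists>b\<le>r. near k (c b) \<and> {k, c b} \<noteq> {j, j'}"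
    using column_assignment[OF assms(1-4)] by metis
  let ?I = "{..<t} \<times> {..r}"
  let ?D = "(\<lambda>(a, b). (3 * a + 1, c b)) ` ?I"
  have "dominating (delete_edges (king_graph (3 * t) (3 * r + 1)) E') ?D"
    unfolding dominating_delete_edges_king_graph
  proof (intro conjI ballI)
    show "?D \<subseteq> {..<3 * t} \<times> {..<3 * r + 1}"
      using c(1) by (force simp: less_Suc_eq_le)
    fix v assume v: "v \<in> {..<3 * t} \<times> {..<3 * r + 1}"
    obtain p k where pk: "v = (p, k)" "p < 3 * t" "k \<le> 3 * r"
      using v by auto
    obtain b where b: "b \<le> r" "near k (c b)" "{k, c b} \<noteq> {j, j'}"
      using c(2) pk by blast
    let ?u = "(3 * (p div 3) + 1, c b)"
    have "p div 3 < t"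
      using pk by linarith
    then have "?u \<in> ?D"
      using b by force
    moreover have "near p (3 * (p div 3) + 1)"
      unfolding near_def by presburger
    moreover have "{v, ?u} \<notin> E'"
    proof
      assume "{v, ?u} \<in> E'"
      from subsetD[OF E' this] have "{v, ?u} = {(i, j), (i', j')}"
        by (rule singletonD)
      then have "snd ` {v, ?u} = snd ` {(i, j), (i', j')}"
        by (rule arg_cong)
      then show False
        using b(3) pk(1) by simp
    qed
    ultimately show "v \<in> ?D \<or> (\<exists>u\<in>?D. u \<noteq> v \<and> near (fst v) (fst u) \<and> near (snd v) (snd u) \<and>
        {v, u} \<notin> E')"
      using b(2) pk(1) by (metis fst_conv snd_conv)
  qed
  then have "domination_number (delete_edges (king_graph (3 * t) (3 * r + 1)) E') \<le> card ?D"
    by (rule domination_number_le)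
  also have "\<dots> \<le> card ?I"
    by (intro card_image_le) simp
  finally show ?thesis
    by simp
qed

lemma edge_king_graph_cases:
  assumes "e \<in> edges (king_graph n m)"
  obtains i j i' j' where "e = {(i, j), (i', j')}" "near j j'" "j < m" "j' < m"
  using assms by (auto simp: strong_product_def adjacent_path_graph)

section \<open>The bondage number\<close>

theorem theorem6:
  fixes n m t r :: nat
  assumes "n \<ge> 2" and "m \<ge> 2"
    and "n = 3 * t" and "m = 3 * r + 1"
  shows "bondage_number (strong_product (path_graph n) (path_graph m)) = 2"
proof -
  have pos: "t > 0" "r > 0"
    using assms by auto
  let ?K = "king_graph (3 * t) (3 * r + 1)"
  let ?E = "{{(0, 0), (1, 0)}, {(0, 0), (1, 1)}} :: (nat \<times> nat) set set"
  have gamma: "domination_number ?K = t * (r + 1)"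
    using domination_number_delete_edge_le[OF pos(2), of 0 0 "{}" _ _ t]
      domination_number_king_graph_ge[of t r]
    by simp
  have "bondage_number ?K = 2"
    unfolding bondage_number_def
  proof (rule Least_equality)
    have "adjacent ?K (0, 0) (1, 0)" "adjacent ?K (0, 0) (1, 1)"
      using pos by (auto simp: adjacent_king_graph near_def)
    then have "?E \<subseteq> edges ?K"
      by (simp add: adjacent_def)
    moreover have "card ?E = 2"
      by (simp add: doubleton_eq_iff)
    ultimately show "\<exists>E'\<subseteq>edges ?K. card E' = 2 \<and>
        domination_number ?K < domination_number (delete_edges ?K E')"
      using domination_number_corner_deleted[OF pos(1), of r] gamma by metis
  next
    fix k
    assume "\<exists>E'\<subseteq>edges ?K. card E' = k \<and>
        domination_number ?K < domination_number (delete_edges ?K E')"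
    then obtain E' where E': "E' \<subseteq> edges ?K" "card E' = k"
      "t * (r + 1) < domination_number (delete_edges ?K E')"
      unfolding gamma by blast
    show "2 \<le> k"
    proof (rule ccontr)
      assume "\<not> 2 \<le> k"
      \<comment> \<open>Finiteness matters: an infinite set would also have \<open>card\<close> equal to 0.\<close>
      have "simple_graph ?K"
        by (intro simple_graph_strong_product simple_graph_path_graph)
      then have "edges ?K \<subseteq> Pow (verts ?K)" "finite (verts ?K)"
        unfolding simple_graph_def by auto
      then have "finite E'"
        using E'(1) finite_subset finite_Pow_iff by metis
      with \<open>\<not> 2 \<le> k\<close> consider "E' = {}" | e where "E' = {e}"
        using E'(2) by (metis One_nat_def card_1_singletonE card_0_eq less_2_cases not_le)
      then obtain i j i' j' where "E' \<subseteq> {{(i, j), (i', j')}}" "near j j'" "j \<le> 3 * r" "j' \<le> 3 * r"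
      proof cases
        case 1
        then show ?thesis
          using that[of 0 0 0 0] by simp
      next
        case (2 e)
        then have "e \<in> edges ?K"
          using E'(1) by simp
        then show ?thesis
          by (rule edge_king_graph_cases) (use that 2 in auto)
      qed
      then have "domination_number (delete_edges ?K E') \<le> t * (r + 1)"
        using domination_number_delete_edge_le[OF pos(2)] by blast
      then show False
        using E'(3) by simp
    qed
  qed
  then show ?thesis
    using assms by simp
qed

end
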